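(* Let $\sigma\subseteq\tau$ be topologies on a set $X$ with $\tau$ $\pi$-semiregular. Let $\kappa$ be an infinite cardinal such that $\tau$ is $\kappa$-Baire, and let $1\leq\alpha\leq\kappa$ be an ordinal. Assume that $\tau$ has a neighborhood $\pi$-basis consisting of sets in $\bigcup_{\xi<\alpha}\mathbf{\Sigma}^{\kappa,0}_{1+\xi}$ with respect to $\sigma$. Then each nonempty $\tau$-open set contains a nonempty $(\sigma,\tau)_\alpha$-open set. In fact, if $\alpha$ is a successor ordinal, then each nonempty $\tau$-open set contains a nonempty $(\sigma,\tau)_{\alpha-1}$-open set.
   Context: All topologies are on a fixed set $X$; $\mathrm{int}_\tau$ denotes interior with respect to $\tau$. For a successor ordinal $\alpha$, $\alpha-1$ is its immediate predecessor. The topologies $(\sigma,\tau)_\xi$: for topologies $\sigma\subseteq\tau$, define by recursion on ordinals $(\sigma,\tau)_0=\sigma$ and, for $\xi>0$, $(\sigma,\tau)_\xi$ is the family of all unions of sets of the form $U\cap\mathrm{int}_\tau(F)$ where, for some $\gamma<\xi$, $U$ is $(\sigma,\tau)_\gamma$-open and $F$ is $(\sigma,\tau)_\gamma$-closed. (Each $(\sigma,\tau)_\xi$ is a topology.) Neighborhood $\pi$-basis of $\tau$: a family $\mathcal{A}$ of subsets of $X$ (not necessarily open) such that for each nonempty $\tau$-open set $B$ there is $A\in\mathcal{A}$ with $\mathrm{int}_\tau(A)\neq\emptyset$ and $A\subseteq B$. $\kappa$-Baire: a set is $\kappa$-meager (with respect to $\tau$) if it is the union of $<\kappa$ many $\tau$-nowhere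 dense sets; $\tau$ is $\kappa$-Baire if the complement of each $\kappa$-meager set is $\tau$-dense. $\pi$-semiregular: a topology is $\pi$-semiregular if each nonempty open set contains a nonempty regular open set, i.e. a nonempty set equal to the interior of its closure. Borel classes (with respect to a given topology): for a cardinal $\nu>0$ (possibly finite) with cardinal successor $\nu^+$, let $\mathbf{S}^\nu_0$ be the family of all open sets and, for $0<\xi<\nu^+$, let $\mathbf{S}^\nu_\xi$ consist of unions of subfamilies of cardinality $\leq\nu$ of complements of sets in $\bigcup_{\gamma<\xi}\mathbf{S}^\nu_\gamma$. For an ordinal $\xi<\kappa$, $\mathbf{\Sigma}^{\kappa,0}_{1+\xi}=\bigcup\{\mathbf{S}^\nu_\xi\mid\nu\text{ a cardinal},\ \nu<\kappa,\ \xi<\nu^+\}$. "With respect to $\sigma$" means these are computed starting from the $\sigma$-open sets. *)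

theory Defs
  imports "HOL-Analysis.Analysis"
begin

unbundle cardinal_syntax

text \<open>
  Ordinals are represented, as in the cardinals library, by well-orders, compared up to isomorphism
  by \<open><o\<close> and \<open>\<le>o\<close>; the ordinal 0 is the empty relation.  For an ordinal \<open>\<xi> :: 'o rel\<close> every
  smaller ordinal is again represented on \<open>'o\<close> (by an initial segment of \<open>\<xi>\<close>), so quantifying over
  all \<open>\<gamma> :: 'o rel\<close> with \<open>\<gamma> <o \<xi>\<close> quantifies over all ordinals below \<open>\<xi>\<close>.  Cardinals are the
  well-orders satisfying \<^const>\<open>Card_order\<close>, finite ones included.
\<close>

definition ord_predecessor :: "'o rel \<Rightarrow> 'o rel \<Rightarrow> bool" where
  "ord_predecessor \<beta> \<alpha> \<longleftrightarrow> \<beta> <o \<alpha> \<and> (\<forall>\<gamma> :: 'o rel. \<gamma> <o \<alpha> \<longrightarrow> \<gamma> \<le>o \<beta>)"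

text \<open>The family of \<open>(\<sigma>,\<tau>)\<^sub>\<xi>\<close>-open sets.\<close>

function gen_open :: "'a topology \<Rightarrow> 'a topology \<Rightarrow> 'o rel \<Rightarrow> 'a set set" where
  "gen_open \<sigma> \<tau> \<xi> =
     (if \<xi> = {} then {U. openin \<sigma> U}
      else {\<Union>\<G> |\<G>. \<G> \<subseteq>
        (\<Union>\<gamma> \<in> {\<gamma>. \<gamma> <o \<xi>}.
          {U \<inter> \<tau> interior_of F |U F.
             U \<in> gen_open \<sigma> \<tau> \<gamma> \<and> F \<subseteq> topspace \<tau> \<and> topspace \<tau> - F \<in> gen_open \<sigma> \<tau> \<gamma>})})"
  by pat_completeness auto
termination
  by (relation "inv_image ordLess (\<lambda>(\<sigma>, \<tau>, \<xi>). \<xi>)") (auto intro: wf_ordLess)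

declare gen_open.simps [simp del]

text \<open>
  The family \<open>\<^bold>S\<^sup>\<nu>\<^sub>\<xi>\<close> relative to \<open>\<sigma>\<close>; the restriction \<open>\<xi> < \<nu>\<^sup>+\<close> is imposed in \<open>borel_Sigma\<close>.
\<close>

function borel_S :: "'a topology \<Rightarrow> 'k rel \<Rightarrow> 'o rel \<Rightarrow> 'a set set" where
  "borel_S \<sigma> \<nu> \<xi> =
     (if \<xi> = {} then {U. openin \<sigma> U}
      else {\<Union>\<G> |\<G>. |\<G>| \<le>o \<nu> \<and>
        \<G> \<subseteq> (\<lambda>B. topspace \<sigma> - B) ` (\<Union>\<gamma> \<in> {\<gamma>. \<gamma> <o \<xi>}. borel_S \<sigma> \<nu> \<gamma>)})"
  by pat_completeness auto
termination
  by (relation "inv_image ordLess (\<lambda>(\<sigma>, \<nu>, \<xi>). \<xi>)") (auto intro: wf_ordLess)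

declare borel_S.simps [simp del]

text \<open>The class \<open>\<^bold>\<Sigma>\<close> of index \<open>1+\<xi>\<close> (not \<open>\<xi>\<close>), so \<open>\<xi> = 0\<close> gives the open sets.\<close>

definition borel_Sigma :: "'k rel \<Rightarrow> 'a topology \<Rightarrow> 'o rel \<Rightarrow> 'a set set" where
  "borel_Sigma \<kappa> \<sigma> \<xi> =
     \<Union>{borel_S \<sigma> \<nu> \<xi> |\<nu> :: 'k rel.
         Card_order \<nu> \<and> \<nu> \<noteq> {} \<and> \<nu> <o \<kappa> \<and> \<xi> <o cardSuc \<nu>}"

definition nbhd_pi_basis :: "'a topology \<Rightarrow> 'a set set \<Rightarrow> bool" where
  "nbhd_pi_basis \<tau> \<A> \<longleftrightarrow> \<A> \<subseteq> Pow (topspace \<tau>) \<and>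
     (\<forall>B. openin \<tau> B \<and> B \<noteq> {} \<longrightarrow> (\<exists>A \<in> \<A>. \<tau> interior_of A \<noteq> {} \<and> A \<subseteq> B))"

definition nowhere_dense_in :: "'a topology \<Rightarrow> 'a set \<Rightarrow> bool" where
  "nowhere_dense_in \<tau> N \<longleftrightarrow> N \<subseteq> topspace \<tau> \<and> \<tau> interior_of (\<tau> closure_of N) = {}"

definition card_meager :: "'k rel \<Rightarrow> 'a topology \<Rightarrow> 'a set \<Rightarrow> bool" where
  "card_meager \<kappa> \<tau> M \<longleftrightarrow>
     (\<exists>\<N>. |\<N>| <o \<kappa> \<and> (\<forall>N \<in> \<N>. nowhere_dense_in \<tau> N) \<and> M = \<Union>\<N>)"

definition card_Baire :: "'k rel \<Rightarrow> 'a topology \<Rightarrow> bool" where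
  "card_Baire \<kappa> \<tau> \<longleftrightarrow>
     (\<forall>M. card_meager \<kappa> \<tau> M \<longrightarrow> \<tau> closure_of (topspace \<tau> - M) = topspace \<tau>)"

definition pi_semiregular :: "'a topology \<Rightarrow> bool" where
  "pi_semiregular \<tau> \<longleftrightarrow>
     (\<forall>U. openin \<tau> U \<and> U \<noteq> {} \<longrightarrow>
       (\<exists>V. V \<noteq> {} \<and> V \<subseteq> U \<and> V = \<tau> interior_of (\<tau> closure_of V)))"

end

theory Submission
  imports Defs
begin

text \<open>
  The recursion defining the topologies \<open>(\<sigma>,\<tau>)\<^sub>\<xi>\<close> mirrors the Borel hierarchy: at each level
  the complement of a set of lower level is replaced by the \<open>\<tau>\<close>-interior of a set that is closed at
  a lower level.  A \<open>\<tau>\<close>-closed set differs from its \<open>\<tau>\<close>-interior only by a nowhere dense set, so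
  by induction on \<open>\<xi>\<close> a set in the Borel class of index \<open>1+\<xi>\<close> over \<open>\<sigma>\<close> agrees with some
  \<open>(\<sigma>,\<tau>)\<^sub>\<xi>\<close>-open set up to a \<open>\<kappa>\<close>-meager set (\<open>borel_Sigma_gen_open_approx\<close>).  This is the
  proof that Borel sets have the Baire property, with a record of which open sets are used.

  Given a nonempty \<open>\<tau>\<close>-open set, shrink it to a nonempty regular open \<open>V\<close>, take a member \<open>A\<close> of the
  neighborhood \<open>\<pi>\<close>-basis inside \<open>V\<close>, and let \<open>U\<close> be the \<open>(\<sigma>,\<tau>)\<^sub>\<xi>\<close>-open approximation of \<open>A\<close>.
  The \<open>\<tau>\<close>-open set \<open>U\<close> is contained in \<open>V\<close> up to a \<open>\<kappa>\<close>-meager set; since \<open>\<tau>\<close> is \<open>\<kappa>\<close>-Baire, \<open>U\<close>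
  has no points outside the closure of \<open>V\<close>, and then \<open>U \<subseteq> V\<close> because \<open>V\<close> is regular open
  (\<open>open_subset_regular_open_mod_meager\<close>).  And \<open>U\<close> is nonempty, for otherwise the nonempty
  interior of \<open>A\<close> would be \<open>\<kappa>\<close>-meager.  The index \<open>\<xi>\<close> lies below \<open>\<alpha>\<close>, hence is at most \<open>\<alpha> - 1\<close> for
  successor \<open>\<alpha>\<close>, and the topologies \<open>(\<sigma>,\<tau>)\<^sub>\<xi>\<close> grow with \<open>\<xi>\<close> (\<open>gen_open_mono\<close>).
\<close>

section \<open>Ordinals and cardinals\<close>

lemma ordLess_empty: "({} :: 'p rel) <o \<xi>" if "Well_order \<xi>" "\<xi> \<noteq> {}" for \<xi> :: "'o rel"
proof (rule ccontr)
  have w: "Well_order ({} :: 'p rel)"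
    by (auto simp: well_order_on_def linear_order_on_def partial_order_on_def preorder_on_def
        refl_on_def trans_def antisym_def total_on_def)
  assume "\<not> ({} :: 'p rel) <o \<xi>"
  then have "\<xi> \<le>o ({} :: 'p rel)"
    using w that by (metis not_ordLess_iff_ordLeq)
  then obtain f where f: "embed \<xi> ({} :: 'p rel) f"
    unfolding ordLeq_def by auto
  then have "f ` Field \<xi> \<subseteq> Field ({} :: 'p rel)"
    using embed_Field[OF f] by blast
  then have "Field \<xi> = {}" by simp
  then show False using that(2) by (auto simp: Field_def)
qed

lemma finite_card_of_ordLess:
  assumes "Cinfinite \<mu>" "finite A"
  shows "|A| <o \<mu>"
  using assms by (intro Cfinite_ordLess_Cinfinite)
    (auto simp: cfinite_def Field_card_of card_of_card_order_on)

section \<open>The topologies generated from a pair\<close>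

lemma gen_open_zero: "gen_open \<sigma> \<tau> {} = {U. openin \<sigma> U}"
  by (simp add: gen_open.simps)

text \<open>
  The sets whose unions make up level \<open>\<xi>\<close>.  The named constant ties the type carrying the smaller
  ordinals \<open>\<gamma>\<close> to the type carrying \<open>\<xi>\<close>, which the recursion equation alone, read inside a
  statement, leaves polymorphic.
\<close>

definition gen_base :: "'a topology \<Rightarrow> 'a topology \<Rightarrow> 'o rel \<Rightarrow> 'a set set" where
  "gen_base \<sigma> \<tau> \<xi> =
     (\<Union>\<gamma> \<in> {\<gamma> :: 'o rel. \<gamma> <o \<xi>}.
        {U \<inter> \<tau> interior_of F |U F.
           U \<in> gen_open \<sigma> \<tau> \<gamma> \<and> F \<subseteq> topspace \<tau> \<and> topspace \<tau> - F \<in> gen_open \<sigma> \<tau> \<gamma>})"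

lemma gen_open_pos: "\<xi> \<noteq> {} \<Longrightarrow> gen_open \<sigma> \<tau> \<xi> = {\<Union>\<G> |\<G>. \<G> \<subseteq> gen_base \<sigma> \<tau> \<xi>}"
  unfolding gen_base_def by (subst gen_open.simps) (simp only: if_False)

lemma gen_open_basic:
  fixes \<gamma> \<xi> :: "'o rel"
  assumes "\<gamma> <o \<xi>" "\<xi> \<noteq> {}" "U \<in> gen_open \<sigma> \<tau> \<gamma>" "F \<subseteq> topspace \<tau>"
    "topspace \<tau> - F \<in> gen_open \<sigma> \<tau> \<gamma>"
  shows "U \<inter> \<tau> interior_of F \<in> gen_open \<sigma> \<tau> \<xi>"
proof -
  have "U \<inter> \<tau> interior_of F \<in> gen_base \<sigma> \<tau> \<xi>"
    using assms unfolding gen_base_def by blast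
  then show ?thesis
    unfolding gen_open_pos[OF assms(2)] by (intro CollectI exI[of _ "{U \<inter> \<tau> interior_of F}"]) auto
qed

lemma gen_open_Union:
  assumes "\<U> \<subseteq> gen_open \<sigma> \<tau> \<xi>"
  shows "\<Union>\<U> \<in> gen_open \<sigma> \<tau> \<xi>"
proof (cases "\<xi> = {}")
  case True
  then show ?thesis using assms by (auto simp: gen_open_zero)
next
  case False
  have "\<forall>U \<in> \<U>. \<exists>\<G> \<subseteq> gen_base \<sigma> \<tau> \<xi>. U = \<Union>\<G>"
    using assms unfolding gen_open_pos[OF False] by blast
  then obtain g where g: "\<And>U. U \<in> \<U> \<Longrightarrow> g U \<subseteq> gen_base \<sigma> \<tau> \<xi>" "\<And>U. U \<in> \<U> \<Longrightarrow> U = \<Union>(g U)"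
    by metis
  have "(\<Union>U \<in> \<U>. g U) \<subseteq> gen_base \<sigma> \<tau> \<xi>"
    using g(1) by (rule UN_least)
  moreover have "(\<Union>U \<in> \<U>. U) = (\<Union>U \<in> \<U>. \<Union>(g U))"
    by (rule SUP_cong[OF refl g(2)])
  then have "\<Union>\<U> = \<Union>(\<Union>U \<in> \<U>. g U)"
    by (simp only: image_ident) blast
  ultimately show ?thesis
    unfolding gen_open_pos[OF False] by blast
qed

lemma gen_open_empty: "{} \<in> gen_open \<sigma> \<tau> \<xi>"
  using gen_open_Union[of "{}"] by simp

lemma gen_open_topspace:
  assumes "topspace \<sigma> = topspace \<tau>" "Well_order \<xi>"
  shows "topspace \<tau> \<in> gen_open \<sigma> \<tau> \<xi>"
proof (cases "\<xi> = {}")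
  case True
  then show ?thesis using assms(1) by (metis gen_open_zero mem_Collect_eq openin_topspace)
next
  case False
  have "topspace \<tau> \<inter> \<tau> interior_of topspace \<tau> \<in> gen_open \<sigma> \<tau> \<xi>"
  proof (rule gen_open_basic[OF ordLess_empty[OF assms(2) False] False])
    show "topspace \<tau> \<in> gen_open \<sigma> \<tau> {}"
      using assms(1) by (metis gen_open_zero mem_Collect_eq openin_topspace)
    show "topspace \<tau> - topspace \<tau> \<in> gen_open \<sigma> \<tau> {}"
      by (simp add: gen_open_empty)
  qed simp
  then show ?thesis by simp
qed

lemma openin_gen_open:
  fixes \<xi> :: "'o rel"
  assumes "\<And>U. openin \<sigma> U \<Longrightarrow> openin \<tau> U" "U \<in> gen_open \<sigma> \<tau> \<xi>"
  shows "openin \<tau> U"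
  using assms(2)
proof (induction \<xi> arbitrary: U rule: wf_induct_rule[OF wf_ordLess])
  case (1 \<xi>)
  show ?case
  proof (cases "\<xi> = {}")
    case True
    then show ?thesis using 1(2) assms(1) by (simp add: gen_open_zero)
  next
    case False
    then obtain \<G> where \<G>: "U = \<Union>\<G>" "\<G> \<subseteq> gen_base \<sigma> \<tau> \<xi>"
      using 1(2) unfolding gen_open_pos[OF False] by blast
    have "openin \<tau> G" if "G \<in> \<G>" for G
    proof -
      obtain \<gamma> :: "'o rel" and U' F
        where "\<gamma> <o \<xi>" "U' \<in> gen_open \<sigma> \<tau> \<gamma>" "G = U' \<inter> \<tau> interior_of F"
        using \<G>(2) \<open>G \<in> \<G>\<close> unfolding gen_base_def by blast
      then show ?thesis using 1(1)[of \<gamma> U'] by (simp add: openin_Int)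
    qed
    then show ?thesis
      unfolding \<G>(1) by (simp add: openin_Union)
  qed
qed

text \<open>
  A level embeds in every later one because \<open>U = U \<inter> int\<^sub>\<tau>(X)\<close> and \<open>X\<close> is closed at every level.
  Levels indexed by isomorphic well-orders coincide since only the order types below the index enter.
\<close>

lemma gen_open_mono:
  fixes \<gamma> \<xi> :: "'o rel"
  assumes "\<And>U. openin \<sigma> U \<Longrightarrow> openin \<tau> U" "\<gamma> \<le>o \<xi>"
  shows "gen_open \<sigma> \<tau> \<gamma> \<subseteq> gen_open \<sigma> \<tau> \<xi>"
proof
  fix U assume U: "U \<in> gen_open \<sigma> \<tau> \<gamma>"
  have wo: "Well_order \<gamma>" "Well_order \<xi>"
    using assms(2) by (auto simp: ordLeq_def)
  consider "\<gamma> = {}" "\<xi> = {}" | "\<gamma> \<noteq> {}" "\<gamma> =o \<xi>" | "\<gamma> <o \<xi>"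
    using assms(2) wo ordLess_empty[of \<xi>] by (metis ordLeq_iff_ordLess_or_ordIso)
  then show "U \<in> gen_open \<sigma> \<tau> \<xi>"
  proof cases
    case 1 then show ?thesis using U by simp
  next
    case 2
    have "\<xi> \<noteq> {}"
      using ordLess_empty[OF wo(1) 2(1)] 2(2) ordLess_ordIso_trans ordLess_irreflexive by blast
    moreover have "\<delta> <o \<gamma> \<longleftrightarrow> \<delta> <o \<xi>" for \<delta> :: "'o rel"
      using 2(2) ordIso_symmetric ordLess_ordIso_trans by blast
    ultimately show ?thesis using U 2(1) by (simp add: gen_open_pos gen_base_def)
  next
    case 3
    then have "\<xi> \<noteq> {}"
      using wo by (metis ordLess_empty ordLess_irreflexive ordLess_transitive)
    then have "U \<inter> \<tau> interior_of topspace \<tau> \<in> gen_open \<sigma> \<tau> \<xi>"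
      using 3 U by (intro gen_open_basic) (auto simp: gen_open_empty)
    moreover have "U \<subseteq> topspace \<tau>"
      using openin_gen_open[OF assms(1) U] openin_subset by blast
    ultimately show ?thesis by (simp add: Int_absorb2)
  qed
qed

section \<open>Approximating Borel sets modulo meager sets\<close>

lemma nowhere_dense_closed_boundary:
  assumes "closedin \<tau> F"
  shows "nowhere_dense_in \<tau> (F - \<tau> interior_of F)"
proof -
  have "closedin \<tau> (F - \<tau> interior_of F)"
    using assms by (simp add: closedin_diff)
  moreover have "\<tau> interior_of (F - \<tau> interior_of F) = {}"
  proof -
    have "\<tau> interior_of (F - \<tau> interior_of F) \<subseteq> \<tau> interior_of F"
      by (simp add: interior_of_mono)
    then show ?thesis
      using interior_of_subset[of \<tau> "F - \<tau> interior_of F"] by blast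
  qed
  ultimately show ?thesis
    unfolding nowhere_dense_in_def by (simp add: closedin_subset closure_of_closedin)
qed

text \<open>
  The exceptional set is bounded by a regular cardinal \<open>\<mu>\<close> above \<open>\<nu>\<close> rather than by \<open>\<kappa>\<close>: the
  induction takes unions of \<open>\<nu>\<close> many meager sets, and for singular \<open>\<kappa>\<close> such a union of \<open>\<kappa>\<close>-meager
  sets need not be visibly \<open>\<kappa>\<close>-meager.
\<close>

lemma borel_S_gen_open_approx:
  fixes \<sigma> \<tau> :: "'a topology" and \<xi> :: "'o rel"
  assumes top: "topspace \<sigma> = topspace \<tau>"
    and sub: "\<And>U. openin \<sigma> U \<Longrightarrow> openin \<tau> U"
    and \<mu>: "Cinfinite \<mu>" "regularCard \<mu>" "\<nu> <o \<mu>"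
    and "A \<in> borel_S \<sigma> \<nu> \<xi>"
  shows "\<exists>U \<in> gen_open \<sigma> \<tau> \<xi>. \<exists>\<N>. |\<N>| <o \<mu> \<and> (\<forall>N \<in> \<N>. nowhere_dense_in \<tau> N) \<and>
    sym_diff A U \<subseteq> \<Union>\<N>"
  using \<open>A \<in> borel_S \<sigma> \<nu> \<xi>\<close>
proof (induction \<xi> arbitrary: A rule: wf_induct_rule[OF wf_ordLess])
  case (1 \<xi>)
  show ?case
  proof (cases "\<xi> = {}")
    case True
    then have "A \<in> gen_open \<sigma> \<tau> \<xi>"
      using 1(2) by (simp add: gen_open_zero borel_S.simps)
    moreover have "|{} :: 'a set set| <o \<mu>"
      using \<mu>(1) by (simp add: finite_card_of_ordLess)
    ultimately show ?thesis by (intro bexI[of _ A] exI[of _ "{}"]) auto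
  next
    case False
    then obtain \<G> where A: "A = \<Union>\<G>" and card\<G>: "|\<G>| \<le>o \<nu>"
      and \<G>: "\<G> \<subseteq> (\<lambda>B. topspace \<sigma> - B) ` (\<Union>\<gamma> \<in> {\<gamma> :: 'o rel. \<gamma> <o \<xi>}. borel_S \<sigma> \<nu> \<gamma>)"
      using 1(2) unfolding borel_S.simps[of \<sigma> \<nu> \<xi>] by auto
    have "\<exists>V \<N>. V \<in> gen_open \<sigma> \<tau> \<xi> \<and> |\<N>| <o \<mu> \<and> (\<forall>N \<in> \<N>. nowhere_dense_in \<tau> N) \<and>
        sym_diff G V \<subseteq> \<Union>\<N>" if "G \<in> \<G>" for G
    proof -
      obtain \<gamma> :: "'o rel" and B
        where \<gamma>: "\<gamma> <o \<xi>" and B: "B \<in> borel_S \<sigma> \<nu> \<gamma>" and G: "G = topspace \<tau> - B"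
        using \<G> \<open>G \<in> \<G>\<close> top by auto
      from 1(1)[OF \<gamma> B] obtain U \<N> where U: "U \<in> gen_open \<sigma> \<tau> \<gamma>" and card\<N>: "|\<N>| <o \<mu>"
        and nd: "\<forall>N \<in> \<N>. nowhere_dense_in \<tau> N" and diff: "sym_diff B U \<subseteq> \<Union>\<N>"
        by blast
      \<comment> \<open>Up to meager sets \<open>G\<close> is the closed set \<open>F\<close>; passing to the interior of \<open>F\<close> costs one
        more nowhere dense set.\<close>
      define F where "F = topspace \<tau> - U"
      have U_open: "openin \<tau> U"
        using openin_gen_open[OF sub U] .
      then have "topspace \<tau> - F = U"
        using openin_subset unfolding F_def by blast
      moreover have "Well_order \<gamma>"
        using \<gamma> by (auto simp: ordLess_def)
      ultimately have "topspace \<tau> \<inter> \<tau> interior_of F \<in> gen_open \<sigma> \<tau> \<xi>"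
        using U gen_open_topspace[OF top]
        by (intro gen_open_basic[OF \<gamma> False]) (auto simp: F_def)
      then have "\<tau> interior_of F \<in> gen_open \<sigma> \<tau> \<xi>"
        by (simp add: Int_absorb1 interior_of_subset_topspace)
      moreover have "|{F - \<tau> interior_of F} \<union> \<N>| <o \<mu>"
        using card\<N> \<mu>(1) finite_card_of_ordLess[OF \<mu>(1), of "{F - \<tau> interior_of F}"]
        by (intro card_of_Un_ordLess_infinite_Field) (auto simp: cinfinite_def)
      moreover have "\<forall>N \<in> {F - \<tau> interior_of F} \<union> \<N>. nowhere_dense_in \<tau> N"
        using nd U_open by (auto simp: F_def intro!: nowhere_dense_closed_boundary)
      moreover have "sym_diff G (\<tau> interior_of F) \<subseteq> \<Union>({F - \<tau> interior_of F} \<union> \<N>)"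
      proof -
        have "sym_diff G F \<subseteq> \<Union>\<N>"
          using diff unfolding G F_def by blast
        then show ?thesis
          using interior_of_subset[of \<tau> F] by blast
      qed
      ultimately show ?thesis by blast
    qed
    then obtain V \<N> where V: "\<And>G. G \<in> \<G> \<Longrightarrow> V G \<in> gen_open \<sigma> \<tau> \<xi>"
      and card\<N>: "\<And>G. G \<in> \<G> \<Longrightarrow> |\<N> G| <o \<mu>"
      and nd: "\<And>G. G \<in> \<G> \<Longrightarrow> \<forall>N \<in> \<N> G. nowhere_dense_in \<tau> N"
      and diff: "\<And>G. G \<in> \<G> \<Longrightarrow> sym_diff G (V G) \<subseteq> \<Union>(\<N> G)"
      by metis
    have "(\<Union>G \<in> \<G>. V G) \<in> gen_open \<sigma> \<tau> \<xi>"
      using V by (intro gen_open_Union) auto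
    moreover have "|\<Union>G \<in> \<G>. \<N> G| <o \<mu>"
      using regularCard_UNION_bound[OF \<mu>(1,2) ordLeq_ordLess_trans[OF card\<G> \<mu>(3)]] card\<N>
      by blast
    moreover have "\<forall>N \<in> (\<Union>G \<in> \<G>. \<N> G). nowhere_dense_in \<tau> N"
      using nd by blast
    moreover have "sym_diff A (\<Union>G \<in> \<G>. V G) \<subseteq> \<Union>(\<Union>G \<in> \<G>. \<N> G)"
    proof -
      have "sym_diff A (\<Union>G \<in> \<G>. V G) \<subseteq> (\<Union>G \<in> \<G>. sym_diff G (V G))"
        unfolding A by blast
      also have "\<dots> \<subseteq> (\<Union>G \<in> \<G>. \<Union>(\<N> G))"
        using diff by (intro UN_mono) auto
      also have "\<dots> = \<Union>(\<Union>G \<in> \<G>. \<N> G)"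
        by blast
      finally show ?thesis .
    qed
    ultimately show ?thesis by blast
  qed
qed

text \<open>
  The regular cardinal needed for \<open>S\<^sup>\<nu>\<close> with \<open>\<nu> < \<kappa>\<close> is \<open>\<omega>\<close> when \<open>\<nu>\<close> is finite and \<open>\<nu>\<^sup>+\<close> when \<open>\<nu>\<close>
  is infinite; either is at most \<open>\<kappa>\<close>, even when \<open>\<kappa>\<close> itself is singular.
\<close>

lemma borel_Sigma_gen_open_approx:
  fixes \<sigma> \<tau> :: "'a topology" and \<kappa> :: "'k rel" and \<xi> :: "'o rel"
  assumes "topspace \<sigma> = topspace \<tau>"
    and "\<And>U. openin \<sigma> U \<Longrightarrow> openin \<tau> U"
    and \<kappa>: "Card_order \<kappa>" "infinite (Field \<kappa>)"
    and "A \<in> borel_Sigma \<kappa> \<sigma> \<xi>"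
  shows "\<exists>U \<in> gen_open \<sigma> \<tau> \<xi>. \<exists>M. card_meager \<kappa> \<tau> M \<and> sym_diff A U \<subseteq> M"
proof -
  obtain \<nu> :: "'k rel" where \<nu>: "Card_order \<nu>" "\<nu> <o \<kappa>" "A \<in> borel_S \<sigma> \<nu> \<xi>"
    using assms(5) unfolding borel_Sigma_def by auto
  have "\<exists>U \<in> gen_open \<sigma> \<tau> \<xi>. \<exists>\<N>. |\<N>| <o \<kappa> \<and> (\<forall>N \<in> \<N>. nowhere_dense_in \<tau> N) \<and>
    sym_diff A U \<subseteq> \<Union>\<N>"
  proof (cases "finite (Field \<nu>)")
    case True
    have "\<nu> <o natLeq"
      using True \<nu>(1) by (intro Cfinite_ordLess_Cinfinite) (auto simp: cfinite_def natLeq_Cinfinite)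
    note borel_S_gen_open_approx[OF assms(1,2) natLeq_Cinfinite regularCard_natLeq this \<nu>(3)]
    moreover have "natLeq \<le>o \<kappa>"
      using \<kappa> by (meson card_of_Field_ordIso infinite_iff_natLeq_ordLeq ordLeq_ordIso_trans)
    ultimately show ?thesis by (meson ordLess_ordLeq_trans)
  next
    case False
    have "Cinfinite (cardSuc \<nu>)"
      using False \<nu>(1) by (intro Cinfinite_cardSuc) (simp add: cinfinite_def)
    moreover have "regularCard (cardSuc \<nu>)"
      using False \<nu>(1) by (simp add: infinite_cardSuc_regularCard)
    ultimately have "\<exists>U \<in> gen_open \<sigma> \<tau> \<xi>. \<exists>\<N>. |\<N>| <o cardSuc \<nu> \<and>
        (\<forall>N \<in> \<N>. nowhere_dense_in \<tau> N) \<and> sym_diff A U \<subseteq> \<Union>\<N>"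
      using borel_S_gen_open_approx[OF assms(1,2) _ _ cardSuc_greater[OF \<nu>(1)] \<nu>(3)] by blast
    moreover have "cardSuc \<nu> \<le>o \<kappa>"
      using \<kappa>(1) \<nu>(1,2) by (simp add: cardSuc_least)
    ultimately show ?thesis by (meson ordLess_ordLeq_trans)
  qed
  then show ?thesis unfolding card_meager_def by blast
qed

section \<open>Open sets in a Baire space\<close>

lemma card_Baire_open_meager_empty:
  assumes "card_Baire \<kappa> \<tau>" "card_meager \<kappa> \<tau> M" "openin \<tau> G" "G \<subseteq> M"
  shows "G = {}"
proof -
  have "\<tau> closure_of (topspace \<tau> - M) = topspace \<tau>"
    using assms(1,2) unfolding card_Baire_def by blast
  then have "G \<inter> (topspace \<tau> - M) \<noteq> {}" if "G \<noteq> {}"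
    using assms(3) that by (metis dense_intersects_open inf_commute)
  then show ?thesis using assms(4) by blast
qed

text \<open>
  The part of \<open>U\<close> outside the closure of \<open>V\<close> is open and meager, hence empty; so \<open>U\<close> is an open
  subset of the closure of \<open>V\<close> and lies in its interior, which is \<open>V\<close>.
\<close>

lemma open_subset_regular_open_mod_meager:
  assumes "card_Baire \<kappa> \<tau>" "card_meager \<kappa> \<tau> M"
    and "openin \<tau> U" "V = \<tau> interior_of (\<tau> closure_of V)" "U - V \<subseteq> M"
  shows "U \<subseteq> V"
proof -
  have "V \<subseteq> topspace \<tau>"
    using assms(4) by (metis interior_of_subset_topspace)
  then have "V \<subseteq> \<tau> closure_of V"
    by (rule closure_of_subset)
  then have "U - \<tau> closure_of V \<subseteq> M"
    using assms(5) by blast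
  moreover have "openin \<tau> (U - \<tau> closure_of V)"
    using assms(3) by (simp add: openin_diff)
  ultimately have "U - \<tau> closure_of V = {}"
    using card_Baire_open_meager_empty[OF assms(1,2)] by blast
  then have "U \<subseteq> \<tau> interior_of (\<tau> closure_of V)"
    using assms(3) by (simp add: interior_of_maximal)
  then show ?thesis using assms(4) by simp
qed

theorem corollary3p6:
  fixes \<sigma> \<tau> :: "'a topology"
    and \<kappa> \<alpha> :: "'k rel"
  assumes "topspace \<sigma> = topspace \<tau>"
    and "\<And>U. openin \<sigma> U \<Longrightarrow> openin \<tau> U"
    and "pi_semiregular \<tau>"
    and "Card_order \<kappa>" and "infinite (Field \<kappa>)"
    and "card_Baire \<kappa> \<tau>"
    and "Well_order \<alpha>" and "\<alpha> \<noteq> {}" and "\<alpha> \<le>o \<kappa>"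
    and "\<exists>\<A>. nbhd_pi_basis \<tau> \<A> \<and> \<A> \<subseteq> (\<Union>\<xi> \<in> {\<xi> :: 'k rel. \<xi> <o \<alpha>}. borel_Sigma \<kappa> \<sigma> \<xi>)"
  shows "(\<forall>B. openin \<tau> B \<and> B \<noteq> {} \<longrightarrow> (\<exists>W \<in> gen_open \<sigma> \<tau> \<alpha>. W \<noteq> {} \<and> W \<subseteq> B)) \<and>
         (\<forall>\<beta>. ord_predecessor \<beta> \<alpha> \<longrightarrow>
           (\<forall>B. openin \<tau> B \<and> B \<noteq> {} \<longrightarrow> (\<exists>W \<in> gen_open \<sigma> \<tau> \<beta>. W \<noteq> {} \<and> W \<subseteq> B)))"
proof -
  obtain \<A> where \<A>: "nbhd_pi_basis \<tau> \<A>"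
    "\<A> \<subseteq> (\<Union>\<xi> \<in> {\<xi> :: 'k rel. \<xi> <o \<alpha>}. borel_Sigma \<kappa> \<sigma> \<xi>)"
    using assms(10) by blast
  have below: "\<exists>\<xi> :: 'k rel. \<xi> <o \<alpha> \<and> (\<exists>W \<in> gen_open \<sigma> \<tau> \<xi>. W \<noteq> {} \<and> W \<subseteq> B)"
    if "openin \<tau> B" "B \<noteq> {}" for B
  proof -
    obtain V where V: "V \<noteq> {}" "V \<subseteq> B" "V = \<tau> interior_of (\<tau> closure_of V)"
      using assms(3) \<open>openin \<tau> B\<close> \<open>B \<noteq> {}\<close> unfolding pi_semiregular_def by metis
    have "openin \<tau> V"
      by (subst V(3)) (rule openin_interior_of)
    then obtain A where A: "A \<in> \<A>" "\<tau> interior_of A \<noteq> {}" "A \<subseteq> V"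
      using \<A>(1) V(1) unfolding nbhd_pi_basis_def by blast
    then obtain \<xi> :: "'k rel" where \<xi>: "\<xi> <o \<alpha>" "A \<in> borel_Sigma \<kappa> \<sigma> \<xi>"
      using \<A>(2) by blast
    from borel_Sigma_gen_open_approx[OF assms(1,2,4,5) \<xi>(2)]
    obtain U M where U: "U \<in> gen_open \<sigma> \<tau> \<xi>" and M: "card_meager \<kappa> \<tau> M" "sym_diff A U \<subseteq> M"
      by blast
    have "openin \<tau> U" using openin_gen_open[OF assms(2) U] .
    moreover have "U - V \<subseteq> M" using M(2) A(3) by blast
    ultimately have "U \<subseteq> V"
      using open_subset_regular_open_mod_meager[OF assms(6) M(1) _ V(3)] by blast
    moreover have "U \<noteq> {}"
    proof
      assume "U = {}"
      then have "\<tau> interior_of A \<subseteq> M"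
        using M(2) interior_of_subset[of \<tau> A] by blast
      then show False
        using card_Baire_open_meager_empty[OF assms(6) M(1) openin_interior_of] A(2) by blast
    qed
    ultimately show ?thesis using U \<xi>(1) V(2) by blast
  qed
  have "\<exists>W \<in> gen_open \<sigma> \<tau> \<delta>. W \<noteq> {} \<and> W \<subseteq> B"
    if "openin \<tau> B" "B \<noteq> {}" "\<And>\<xi> :: 'k rel. \<xi> <o \<alpha> \<Longrightarrow> \<xi> \<le>o \<delta>" for B and \<delta> :: "'k rel"
    using below[OF that(1,2)] gen_open_mono[OF assms(2) that(3)] by blast
  then show ?thesis
    unfolding ord_predecessor_def using ordLess_imp_ordLeq by metis
qed

end
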